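(* Let $\mu$ be an infinite cardinal and $\lambda\geq\mu^{+3}$, and let $f\colon[\lambda]^4\to[\lambda]^{<\mu}$ be a set mapping such that for all $x_0<x_1<x_2<x_3$ in $\lambda$, $f\{x_0,x_1,x_2,x_3\}\cap(x_1,x_2)=\emptyset$, where $(x_1,x_2)=\{y\in\lambda: x_1<y<x_2\}$. Then for every natural number $m$, $f$ has a free set of size $m$.
   Context: For a set $S$, $[S]^k$ denotes the set of $k$-element subsets of $S$ and $[S]^{<\mu}$ the set of subsets of cardinality $<\mu$. A set mapping $f\colon[\lambda]^4\to[\lambda]^{<\mu}$ is a function with $f(\bar x)\cap\bar x=\emptyset$ for all $\bar x\in[\lambda]^4$; a set $H\subseteq\lambda$ is free for $f$ if $f(\bar x)\cap H=\emptyset$ for every $\bar x\in[H]^4$. *)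

theory Defs
  imports Main
begin

text \<open>The cardinal \<lambda> is modelled as a cardinal order r (an initial well-order);
its elements are Field r, ordered by r. Cardinals are compared with ordLeq / ordLess.\<close>

definition strict_rel :: "'a rel \<Rightarrow> 'a \<Rightarrow> 'a \<Rightarrow> bool" where
  "strict_rel r x y \<longleftrightarrow> (x, y) \<in> r \<and> x \<noteq> y"

definition open_interval :: "'a rel \<Rightarrow> 'a \<Rightarrow> 'a \<Rightarrow> 'a set" where
  "open_interval r a b = {y \<in> Field r. strict_rel r a y \<and> strict_rel r y b}"

definition set_mapping4 :: "'a rel \<Rightarrow> 'b rel \<Rightarrow> ('a set \<Rightarrow> 'a set) \<Rightarrow> bool" where
  "set_mapping4 r mu f \<longleftrightarrow>
     (\<forall>x. x \<subseteq> Field r \<and> finite x \<and> card x = 4 \<longrightarrow>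
        f x \<subseteq> Field r \<and> (card_of (f x), mu) \<in> ordLess \<and> f x \<inter> x = {})"

definition free_set4 :: "('a set \<Rightarrow> 'a set) \<Rightarrow> 'a set \<Rightarrow> bool" where
  "free_set4 f H \<longleftrightarrow> (\<forall>x. x \<subseteq> H \<and> finite x \<and> card x = 4 \<longrightarrow> f x \<inter> H = {})"

end

(*
  One chooses sets A_0 < A_1 < A_2 < ..., each of size mu^+, such that f(x0,x1,x2,z) misses A_i whenever
  x0, x1, x2 lie in earlier and z in later sets, and f(x0,x1,x2,x3) misses A_i whenever x0, ..., x3 lie
  in earlier sets. For the first property, take mu^{++} disjoint candidates for A_i: the union of the
  values f(x0,x1,x2,z) for fixed z has size at most mu^+, so it misses some candidate, and by the
  pigeonhole principle one candidate serves mu^{+3} of the points z. A free set is then picked with one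
  point from each of A_{n-1}, ..., A_0, downwards. The only points that could still be hit by a value
  f(x0,...,x3) with x0 not yet chosen lie between x0 and x1, the gap (x1,x2) being excluded by
  hypothesis; since a value of size < mu excludes few
  points, the next point can be picked so that mu^+ many x0 in every remaining A_i stay good.
*)
theory Submission
  imports Defs "HOL-Library.Ramsey"
begin

unbundle cardinal_syntax

section \<open>Cardinal arithmetic relative to a cardinal order \<open>k\<close>\<close>

lemma small_subset: "\<lbrakk>|B| \<le>o k; A \<subseteq> B\<rbrakk> \<Longrightarrow> |A| \<le>o k"
  using card_of_mono1 ordLeq_transitive by blast

text \<open>Largeness is written as a negated bound throughout, so that covers by few small sets
  refute it directly; this recovers an inequality of cardinals where an injection has to be
  extracted.\<close>

lemma not_small_iff:
  assumes "Card_order k"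
  shows "\<not> |A| \<le>o k \<longleftrightarrow> k <o |A|"
  using not_ordLeq_iff_ordLess[OF _ card_of_Well_order] card_order_on_well_order_on[OF assms] by blast

lemma not_small_cardSuc:
  assumes "Card_order k" "|A| =o cardSuc k"
  shows "\<not> |A| \<le>o k"
  unfolding not_small_iff[OF assms(1)]
  using cardSuc_greater[OF assms(1)] ordIso_symmetric[OF assms(2)] by (rule ordLess_ordIso_trans)

lemma card_of_inj_image_Field:
  assumes "Card_order k" "inj_on g (Field k)"
  shows "|g ` Field k| =o k"
proof -
  have "|Field k| =o |g ` Field k|"
    using assms(2) by (intro card_of_ordIsoI[of g]) (simp add: bij_betw_def)
  then show ?thesis
    using card_of_Field_ordIso[OF assms(1)] ordIso_symmetric ordIso_transitive by blast
qed

lemma small_finite: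
  assumes "Card_order k" "infinite (Field k)" "finite A"
  shows "|A| \<le>o k"
proof -
  have "|A| \<le>o |Field k|"
    using assms(2,3) by (meson card_of_Well_order card_of_ordLeq_finite ordLeq_total)
  then show ?thesis
    using card_of_Field_ordIso[OF assms(1)] ordLeq_ordIso_trans by blast
qed

lemma small_nsets:
  assumes "Card_order k" "infinite (Field k)" "|B| \<le>o k"
  shows "|[B]\<^bsup>n\<^esup>| \<le>o k"
proof (induction n)
  case 0
  then show ?case
    using assms by (simp add: small_finite)
next
  case (Suc n)
  have "[B]\<^bsup>Suc n\<^esup> \<subseteq> (\<lambda>(x, X). insert x X) ` (B \<times> [B]\<^bsup>n\<^esup>)"
  proof
    fix X assume "X \<in> [B]\<^bsup>Suc n\<^esup>"
    then have X: "X \<subseteq> B" "finite X" "card X = Suc n"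
      by (auto simp: nsets_def)
    then obtain x Y where "X = insert x Y" "x \<notin> Y" "card Y = n"
      by (metis card_Suc_eq)
    with X show "X \<in> (\<lambda>(x, X). insert x X) ` (B \<times> [B]\<^bsup>n\<^esup>)"
      by (auto simp: nsets_def)
  qed
  then have "|[B]\<^bsup>Suc n\<^esup>| \<le>o |B \<times> [B]\<^bsup>n\<^esup>|"
    by (rule surj_imp_ordLeq)
  moreover have "|B \<times> [B]\<^bsup>n\<^esup>| \<le>o k"
    using card_of_Times_ordLeq_infinite_Field assms Suc.IH by blast
  ultimately show ?case
    by (rule ordLeq_transitive)
qed

text \<open>A finite index set keeps the bound strict even for singular \<open>k\<close>. The use is
  for unions of values of \<open>f\<close> over tuples from the finitely many points already
  picked.\<close>

lemma finite_UNION_ordLess: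
  assumes "Card_order k" "infinite (Field k)" "finite I" "\<And>i. i \<in> I \<Longrightarrow> |A i| <o k"
  shows "|\<Union>i\<in>I. A i| <o k"
  using assms(3,4)
proof (induction I rule: finite_induct)
  case empty
  have "|{}| <o |Field k|"
    using assms(2) card_of_ordLess[of "Field k" "{}"] by auto
  then show ?case
    using card_of_Field_ordIso[OF assms(1)] ordLess_ordIso_trans by auto
next
  case (insert i I)
  then show ?case
    using card_of_Un_ordLess_infinite_Field[OF assms(2,1)] by auto
qed

section \<open>Avoidance by pigeonhole, and short initial segments\<close>

text \<open>The engine for choosing a block, used with mu^+ as \<open>k\<close>: disjoint candidates
  outnumber the points of each \<open>F z\<close>, yet are few enough for one of them to serve a
  large set of \<open>z\<close>.\<close>

lemma big_avoid:
  assumes "Card_order k" "infinite (Field k)"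
    and Z: "\<not> |Z| \<le>o cardSuc k"
    and F: "\<And>z. z \<in> Z \<Longrightarrow> |F z| \<le>o k"
  obtains A Z' where "A \<subseteq> Z" "|A| =o k" "Z' \<subseteq> Z" "\<not> |Z'| \<le>o cardSuc k"
    "\<And>z. z \<in> Z' \<Longrightarrow> F z \<inter> A = {}"
proof -
  let ?I = "Field (cardSuc k)"
  note cS = cardSuc_Card_order[OF assms(1)]
  have infS: "infinite ?I"
    using cardSuc_finite assms(1,2) by blast
  have I: "|?I| =o cardSuc k"
    using card_of_Field_ordIso[OF cS] .
  have K: "|Field k| =o k"
    using card_of_Field_ordIso[OF assms(1)] .
  have "|Field k| \<le>o cardSuc k"
    using K cardSuc_ordLeq[OF assms(1)] ordIso_ordLeq_trans by blast
  then have "|?I \<times> Field k| \<le>o cardSuc k"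
    using card_of_Times_ordLeq_infinite_Field[OF infS _ _ cS] I ordIso_iff_ordLeq by blast
  moreover have "cardSuc k \<le>o |Z|"
    using Z not_small_iff[OF cS] ordLess_imp_ordLeq by blast
  ultimately have "|?I \<times> Field k| \<le>o |Z|"
    by (rule ordLeq_transitive)
  then obtain g where g: "inj_on g (?I \<times> Field k)" "g ` (?I \<times> Field k) \<subseteq> Z"
    using card_of_ordLeq[of "?I \<times> Field k" Z] by blast
  \<comment> \<open>For \<open>a\<close> in \<open>?I\<close>, these are k^+ disjoint subsets of
    \<open>Z\<close>, each of size k.\<close>
  define W where "W a = g ` ({a} \<times> Field k)" for a
  have "\<exists>a\<in>?I. F z \<inter> W a = {}" if z: "z \<in> Z" for z
  proof (rule ccontr)
    assume *: "\<not> ?thesis"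
    \<comment> \<open>If \<open>F z\<close> met every \<open>W a\<close>, reading off the index
      \<open>a\<close> would map \<open>F z\<close> onto a set covering \<open>?I\<close>, although
      \<open>F z\<close> has size at most k and \<open>?I\<close> has size k^+.\<close>
    have "?I \<subseteq> (\<lambda>w. fst (inv_into (?I \<times> Field k) g w)) ` F z"
    proof
      fix a assume a: "a \<in> ?I"
      with * obtain b where b: "b \<in> Field k" "g (a, b) \<in> F z"
        by (auto simp: W_def)
      then have "inv_into (?I \<times> Field k) g (g (a, b)) = (a, b)"
        using a g by (intro inv_into_f_f) auto
      with b show "a \<in> (\<lambda>w. fst (inv_into (?I \<times> Field k) g w)) ` F z"
        by (intro image_eqI[of _ _ "g (a, b)"]) simp_all
    qed
    then have "|?I| \<le>o k"
      by (rule ordLeq_transitive[OF surj_imp_ordLeq F[OF z]])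
    then have "cardSuc k \<le>o k"
      by (rule ordIso_ordLeq_trans[OF ordIso_symmetric[OF I]])
    then show False
      using cardSuc_greater[OF assms(1)] not_ordLess_ordLeq by blast
  qed
  then obtain h where h: "\<And>z. z \<in> Z \<Longrightarrow> h z \<in> ?I \<and> F z \<inter> W (h z) = {}"
    by metis
  \<comment> \<open>Pigeonhole: if all k^+ fibres of \<open>h\<close> had size at most k^+, so would
    their union \<open>Z\<close>.\<close>
  have "\<exists>a\<in>?I. \<not> |{z\<in>Z. h z = a}| \<le>o cardSuc k"
  proof (rule ccontr)
    assume "\<not> ?thesis"
    then have "|\<Union>a\<in>?I. {z\<in>Z. h z = a}| \<le>o cardSuc k"
      using I ordIso_iff_ordLeq
      by (intro card_of_UNION_ordLeq_infinite_Field[OF infS cS]) auto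
    moreover have "Z = (\<Union>a\<in>?I. {z\<in>Z. h z = a})"
      using h by auto
    ultimately show False
      using Z by simp
  qed
  then obtain a where a: "a \<in> ?I" "\<not> |{z\<in>Z. h z = a}| \<le>o cardSuc k"
    by blast
  have "inj_on (\<lambda>b. g (a, b)) (Field k)"
    using g(1) a(1) by (auto simp: inj_on_def)
  moreover have "W a = (\<lambda>b. g (a, b)) ` Field k"
    by (auto simp: W_def)
  ultimately have "|W a| =o k"
    using card_of_inj_image_Field[OF assms(1)] by simp
  moreover have "W a \<subseteq> Z"
    using g(2) a(1) by (auto simp: W_def)
  moreover have "\<And>z. z \<in> {z\<in>Z. h z = a} \<Longrightarrow> F z \<inter> W a = {}"
    using h by blast
  ultimately show ?thesis
    using that[of "W a" "{z\<in>Z. h z = a}"] a(2) by blast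
qed

lemma big_diff:
  assumes "Card_order k" "infinite (Field k)" "\<not> |Z| \<le>o k" "|D| \<le>o k"
  shows "\<not> |Z - D| \<le>o k"
proof
  assume "|Z - D| \<le>o k"
  then have "|(Z - D) \<union> D| \<le>o k"
    using card_of_Un_ordLeq_infinite_Field assms by blast
  then have "|Z| \<le>o k"
    by (rule small_subset) auto
  with assms(3) show False ..
qed

text \<open>Even when \<open>r\<close> is much longer, its initial segment of type k^+ suffices.
  Used with mu^{++} as \<open>k\<close>, it allows everything not above a new block to be discarded
  without exhausting the supply of points.\<close>

lemma big_with_small_segments:
  assumes k: "Card_order k" "infinite (Field k)"
    and le: "cardSuc k \<le>o r"
  obtains Z where "Z \<subseteq> Field r" "\<not> |Z| \<le>o k" "\<And>z. z \<in> Z \<Longrightarrow> |{w\<in>Z. (w, z) \<in> r}| \<le>o k"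
proof -
  let ?s = "cardSuc k"
  note cS = cardSuc_Card_order[OF k(1)]
  obtain e where e: "embed ?s r e"
    using le by (auto simp: ordLeq_def)
  have ws: "Well_order ?s"
    using cS by (rule card_order_on_well_order_on)
  have inj: "inj_on e (Field ?s)"
    using embed_inj_on[OF ws e] .
  let ?Z = "e ` Field ?s" \<comment> \<open>an initial segment of \<open>r\<close> of order type \<open>k\<^sup>+\<close>\<close>
  have "\<not> |?Z| \<le>o k"
    using not_small_cardSuc[OF k(1)] card_of_inj_image_Field[OF cS inj] .
  moreover have "?Z \<subseteq> Field r"
    using embed_Field[OF e] .
  moreover have "|{w\<in>?Z. (w, z) \<in> r}| \<le>o k" if z: "z \<in> ?Z" for z
  proof -
    obtain a where a: "a \<in> Field ?s" "z = e a"
      using z by blast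
    \<comment> \<open>The embedding carries the predecessors of \<open>a\<close> in
      \<open>?s\<close> onto those of \<open>e a\<close> in \<open>r\<close>, and a point of the
      cardinal k^+ has at most k predecessors.\<close>
    have "{w\<in>?Z. (w, z) \<in> r} \<subseteq> e ` (underS ?s a \<union> {a})"
    proof
      fix w assume "w \<in> {w\<in>?Z. (w, z) \<in> r}"
      then have "w \<in> underS r z \<union> {z}"
        by (auto simp: underS_def)
      moreover have "underS r z = e ` underS ?s a"
        using embed_underS[OF ws e a(1)] a(2) by (simp add: bij_betw_def)
      ultimately show "w \<in> e ` (underS ?s a \<union> {a})"
        using a(2) by auto
    qed
    then have "|{w\<in>?Z. (w, z) \<in> r}| \<le>o |underS ?s a \<union> {a}|"
      by (rule surj_imp_ordLeq)
    moreover have "|underS ?s a| \<le>o k"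
      using card_of_underS[OF cS a(1)] cardSuc_ordLeq_ordLess[OF k(1) card_of_Card_order] by blast
    then have "|underS ?s a \<union> {a}| \<le>o k"
      using small_finite[OF k, of "{a}"]
      by (intro card_of_Un_ordLeq_infinite_Field[OF k(2) _ _ k(1)]) simp_all
    ultimately show ?thesis
      by (rule ordLeq_transitive)
  qed
  ultimately show ?thesis
    using that by blast
qed

section \<open>Construction of the increasing blocks\<close>

lemma set_mapping4_nsets:
  assumes "set_mapping4 r mu f" "B \<subseteq> Field r" "X \<in> [B]\<^bsup>4\<^esup>"
  shows "f X \<subseteq> Field r" "|f X| <o mu" "f X \<inter> X = {}"
proof -
  have "X \<subseteq> Field r" "finite X" "card X = 4"
    using assms(2,3) by (auto simp: nsets_def)
  then show "f X \<subseteq> Field r" "|f X| <o mu" "f X \<inter> X = {}"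
    using assms(1) by (simp_all add: set_mapping4_def)
qed

lemma insert_nsets:
  assumes "X \<in> [B]\<^bsup>3\<^esup>" "z \<notin> B"
  shows "insert z X \<in> [insert z B]\<^bsup>4\<^esup>"
proof -
  have "X \<subseteq> B" "finite X" "card X = 3" "z \<notin> X"
    using assms by (auto simp: nsets_def)
  then show ?thesis
    by (auto simp: nsets_def)
qed

text \<open>Recursion on pairs \<open>(B, Z)\<close>: \<open>B\<close> is the union of the blocks so
  far, \<open>Z\<close> a reservoir above \<open>B\<close> for all later points. Keeping
  \<open>B\<close> of size at most mu^+ bounds the number of its triples by mu^+, as
  \<open>big_avoid\<close> requires; \<open>Z\<close> stays larger than mu^{++}, so the recursion
  never stops.\<close>

lemma blocks_exist:
  fixes r :: "'a rel" and mu :: "'b rel"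
  assumes mu: "Card_order mu" "infinite (Field mu)" and r: "Card_order r"
    and le: "cardSuc (cardSuc (cardSuc mu)) \<le>o r"
    and f: "set_mapping4 r mu f"
  obtains A :: "nat \<Rightarrow> 'a set" where
    "\<And>i. A i \<subseteq> Field r" "\<And>i. \<not> |A i| \<le>o mu"
    "\<And>i j a b. \<lbrakk>i < j; a \<in> A i; b \<in> A j\<rbrakk> \<Longrightarrow> strict_rel r a b"
    "\<And>i j z X. \<lbrakk>i < j; z \<in> A j; X \<in> [\<Union>k<i. A k]\<^bsup>3\<^esup>\<rbrakk> \<Longrightarrow> f (insert z X) \<inter> A i = {}"
    "\<And>i X. X \<in> [\<Union>k<i. A k]\<^bsup>4\<^esup> \<Longrightarrow> f X \<inter> A i = {}"
proof -
  let ?k1 = "cardSuc mu"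
  let ?k2 = "cardSuc ?k1"
  have k1: "Card_order ?k1" "infinite (Field ?k1)"
    using mu cardSuc_Card_order cardSuc_finite by blast+
  have k2: "Card_order ?k2" "infinite (Field ?k2)"
    using k1 cardSuc_Card_order cardSuc_finite by blast+
  have up: "|X| \<le>o ?k2" if "|X| \<le>o ?k1" for X :: "'a set"
    using that cardSuc_ordLeq[OF k1(1)] ordLeq_transitive by blast
  obtain Z0 where Z0: "Z0 \<subseteq> Field r" "\<not> |Z0| \<le>o ?k2"
    and seg: "\<And>z. z \<in> Z0 \<Longrightarrow> |{w\<in>Z0. (w, z) \<in> r}| \<le>o ?k2"
    using big_with_small_segments[OF k2 le] by blast
  have wr: "wo_rel r"
    using r by (simp add: wo_rel_def card_order_on_well_order_on)
  have value_small: "|f X| \<le>o ?k1" if "X \<in> [B]\<^bsup>4\<^esup>" "B \<subseteq> Field r" for X B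
    using ordLeq_transitive[OF ordLess_imp_ordLeq[OF set_mapping4_nsets(2)[OF f that(2,1)]]
        cardSuc_ordLeq[OF mu(1)]] .
  define inv :: "'a set \<times> 'a set \<Rightarrow> bool" where
    "inv = (\<lambda>(B, Z). B \<subseteq> Field r \<and> |B| \<le>o ?k1 \<and> Z \<subseteq> Z0 \<and> \<not> |Z| \<le>o ?k2 \<and>
       (\<forall>b\<in>B. \<forall>z\<in>Z. strict_rel r b z) \<and> (\<forall>X\<in>[B]\<^bsup>4\<^esup>. f X \<inter> Z = {}))"
  \<comment> \<open>The new block \<open>A\<close> is a parameter of the transition relation, so
    that it can be recovered from the sequence of states. The triples come from the old
    \<open>B\<close>, hence from blocks strictly before \<open>A\<close>.\<close>
  define Q :: "'a set \<Rightarrow> 'a set \<times> 'a set \<Rightarrow> 'a set \<times> 'a set \<Rightarrow> bool" where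
    "Q A = (\<lambda>(B, Z) (B', Z'). A \<subseteq> Z \<and> \<not> |A| \<le>o mu \<and> B' = B \<union> A \<and> Z' \<subseteq> Z \<and>
       (\<forall>z\<in>Z'. \<forall>X\<in>[B]\<^bsup>3\<^esup>. f (insert z X) \<inter> A = {}))" for A
  have step: "\<exists>t. inv t \<and> (\<exists>A. Q A s t)" if "inv s" for s
  proof -
    obtain B Z where s: "s = (B, Z)"
      by (cases s)
    have B: "B \<subseteq> Field r" "|B| \<le>o ?k1" and Z: "Z \<subseteq> Z0" "\<not> |Z| \<le>o ?k2"
      and BZ: "\<forall>b\<in>B. \<forall>z\<in>Z. strict_rel r b z"
      using that by (auto simp: s inv_def)
    define F where "F z = (\<Union>X\<in>[B]\<^bsup>3\<^esup>. f (insert z X))" for z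
    have "|F z| \<le>o ?k1" if z: "z \<in> Z" for z
    proof -
      have "z \<notin> B"
        using BZ z by (auto simp: strict_rel_def)
      then have "|f (insert z X)| \<le>o ?k1" if "X \<in> [B]\<^bsup>3\<^esup>" for X
        using value_small[OF insert_nsets[OF that]] B(1) Z(1) Z0(1) z by auto
      then show ?thesis
        unfolding F_def
        by (intro card_of_UNION_ordLeq_infinite_Field[OF k1(2,1)] small_nsets[OF k1 B(2)]) auto
    qed
    then obtain A Z1 where A: "A \<subseteq> Z" "|A| =o ?k1" and Z1: "Z1 \<subseteq> Z" "\<not> |Z1| \<le>o ?k2"
      and FA: "\<And>z. z \<in> Z1 \<Longrightarrow> F z \<inter> A = {}"
      using big_avoid[OF k1 Z(2)] by blast
    have "\<not> |A| \<le>o mu"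
      using not_small_cardSuc[OF mu(1)] A(2) .
    have A1: "|A| \<le>o ?k1"
      using A(2) ordIso_iff_ordLeq by blast
    \<comment> \<open>To be removed from the reservoir: points not above all of \<open>A\<close>, at
      most mu^{++} by \<open>seg\<close>, and values at quadruples from the enlarged
      \<open>B\<close>, at most mu^+.\<close>
    define D where "D = (\<Union>a\<in>A. {w\<in>Z0. (w, a) \<in> r}) \<union> (\<Union>X\<in>[B \<union> A]\<^bsup>4\<^esup>. f X)"
    have BA: "B \<union> A \<subseteq> Field r" "|B \<union> A| \<le>o ?k1"
      using B A(1) A1 Z(1) Z0(1) card_of_Un_ordLeq_infinite_Field[OF k1(2) _ _ k1(1)] by auto
    have "|\<Union>X\<in>[B \<union> A]\<^bsup>4\<^esup>. f X| \<le>o ?k1"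
      using value_small BA
      by (intro card_of_UNION_ordLeq_infinite_Field[OF k1(2,1)] small_nsets[OF k1]) auto
    moreover have "|\<Union>a\<in>A. {w\<in>Z0. (w, a) \<in> r}| \<le>o ?k2"
      using seg A(1) Z(1) up[OF A1]
      by (intro card_of_UNION_ordLeq_infinite_Field[OF k2(2,1)]) auto
    ultimately have "|D| \<le>o ?k2"
      unfolding D_def using up card_of_Un_ordLeq_infinite_Field[OF k2(2) _ _ k2(1)] by blast
    then have Z': "\<not> |Z1 - D| \<le>o ?k2"
      using big_diff[OF k2] Z1(2) by blast
    have "strict_rel r a z" if "a \<in> A" "z \<in> Z1 - D" for a z
    proof -
      have "z \<in> Z0" "a \<in> Z0" "(z, a) \<notin> r"
        using that A(1) Z1(1) Z(1) by (auto simp: D_def)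
      then show ?thesis
        using Z0(1) wo_rel.TOTALS[OF wr] wo_rel.REFL[OF wr]
        unfolding strict_rel_def refl_on_def by blast
    qed
    moreover have "f X \<inter> (Z1 - D) = {}" if "X \<in> [B \<union> A]\<^bsup>4\<^esup>" for X
      using that by (auto simp: D_def)
    ultimately have "inv (B \<union> A, Z1 - D)"
      using BA Z1(1) Z(1) Z' BZ unfolding inv_def by blast
    moreover have "f (insert z X) \<inter> A = {}" if "z \<in> Z1 - D" "X \<in> [B]\<^bsup>3\<^esup>" for z X
      using FA[of z] that by (auto simp: F_def)
    then have "Q A s (B \<union> A, Z1 - D)"
      using A(1) \<open>\<not> |A| \<le>o mu\<close> Z1(1) unfolding Q_def s by blast
    ultimately show ?thesis
      by blast
  qed
  have inv0: "inv ({}, Z0)"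
    using Z0 Card_order_empty[OF k1(1)] by (auto simp: inv_def nsets_def)
  \<comment> \<open>Dependent choice; the clause for \<open>n = 0\<close> fixes the start, so that
    \<open>B 0\<close> is empty.\<close>
  have "\<exists>s. \<forall>n. (inv (s n) \<and> (n = 0 \<longrightarrow> s n = ({}, Z0))) \<and> (\<exists>A. Q A (s n) (s (Suc n)))"
    by (rule dependent_nat_choice) (use inv0 step in auto)
  then obtain s where s: "\<And>n. inv (s n)" "s 0 = ({}, Z0)" "\<And>n. \<exists>A. Q A (s n) (s (Suc n))"
    by blast
  then obtain A where Q: "\<And>n. Q (A n) (s n) (s (Suc n))"
    by metis
  define B where "B n = fst (s n)" for n
  define Z where "Z n = snd (s n)" for n
  have "B n = (\<Union>k<n. A k)" for n
  proof (induction n)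
    case 0
    then show ?case
      by (simp add: B_def s)
  next
    case (Suc n)
    then show ?case
      using Q[of n] by (auto simp: B_def Q_def lessThan_Suc split: prod.splits)
  qed
  note B_eq = this
  have anti: "Z (Suc n) \<subseteq> Z n" for n
    using Q[of n] by (auto simp: Z_def Q_def split: prod.splits)
  have AZ: "A n \<subseteq> Z n" for n
    using Q[of n] by (auto simp: Z_def Q_def split: prod.splits)
  have AZ': "A j \<subseteq> Z i" if "i \<le> j" for i j
    using lift_Suc_antimono_le[of Z, OF anti that] AZ by blast
  show ?thesis
  proof
    fix i
    show "A i \<subseteq> Field r"
      using AZ[of i] s(1)[of i] Z0(1) by (auto simp: Z_def inv_def split: prod.splits)
    show "\<not> |A i| \<le>o mu"
      using Q[of i] by (auto simp: Q_def split: prod.splits)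
    show "f X \<inter> A i = {}" if "X \<in> [\<Union>k<i. A k]\<^bsup>4\<^esup>" for X
    proof -
      have "f X \<inter> Z i = {}"
        using that s(1)[of i] unfolding B_eq[symmetric]
        by (simp add: inv_def B_def Z_def case_prod_beta)
      then show ?thesis
        using AZ[of i] by blast
    qed
  next
    fix i j a b assume "i < j" "a \<in> A i" "b \<in> A j"
    then have "a \<in> B j" "b \<in> Z j"
      using AZ B_eq by auto
    then show "strict_rel r a b"
      using s(1)[of j] by (auto simp: inv_def B_def Z_def split: prod.splits)
  next
    fix i j z X assume "i < j" "z \<in> A j" "X \<in> [\<Union>k<i. A k]\<^bsup>3\<^esup>"
    \<comment> \<open>Only the reservoir left after choosing \<open>A i\<close> is known to avoid
      it; \<open>i < j\<close> puts \<open>z\<close> there.\<close>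
    then have "z \<in> Z (Suc i)" "X \<in> [B i]\<^bsup>3\<^esup>"
      using AZ'[of "Suc i" j] by (auto simp: B_eq)
    then show "f (insert z X) \<inter> A i = {}"
      using Q[of i] by (auto simp: Q_def B_def Z_def split: prod.splits)
  qed
qed

section \<open>Picking the free set downwards\<close>

text \<open>Take mu many bad \<open>y\<close>. Each is missed by \<open>G x\<close> for at most mu
  points \<open>x\<close>, so some \<open>x\<close> in the larger set \<open>C\<close> has all of
  them in \<open>G x\<close>, against the size of \<open>G x\<close>. Regularity of
  \<open>mu\<close> does not enter.\<close>

lemma few_bad:
  fixes mu :: "'b rel" and G :: "'a \<Rightarrow> 'c set"
  assumes mu: "Card_order mu" "infinite (Field mu)"
    and C: "\<not> |C| \<le>o mu" and G: "\<And>x. x \<in> C \<Longrightarrow> |G x| <o mu"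
  shows "|{y. |{x\<in>C. y \<notin> G x}| \<le>o mu}| \<le>o mu"
proof (rule ccontr)
  let ?Y = "{y. |{x\<in>C. y \<notin> G x}| \<le>o mu}"
  assume "\<not> |?Y| \<le>o mu"
  then have "mu \<le>o |?Y|"
    using not_small_iff[OF mu(1)] ordLess_imp_ordLeq by blast
  then have "|Field mu| \<le>o |?Y|"
    using card_of_Field_ordIso[OF mu(1)] ordIso_ordLeq_trans by blast
  then obtain g where g: "inj_on g (Field mu)" "g ` Field mu \<subseteq> ?Y"
    using card_of_ordLeq[of "Field mu" ?Y] by blast
  have iso: "|g ` Field mu| =o mu"
    using card_of_inj_image_Field[OF mu(1) g(1)] .
  have "|\<Union>y\<in>g ` Field mu. {x\<in>C. y \<notin> G x}| \<le>o mu"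
    using g(2) iso ordIso_iff_ordLeq
    by (intro card_of_UNION_ordLeq_infinite_Field[OF mu(2,1)]) auto
  then have "\<not> C \<subseteq> (\<Union>y\<in>g ` Field mu. {x\<in>C. y \<notin> G x})"
    using C small_subset by blast
  then obtain x where x: "x \<in> C" "g ` Field mu \<subseteq> G x"
    by blast
  then have "mu \<le>o |G x|"
    using ordIso_ordLeq_trans[OF ordIso_symmetric[OF iso] card_of_mono1] by blast
  then show False
    using G[OF x(1)] not_ordLess_ordLeq by blast
qed

text \<open>Points are picked downwards; \<open>C i\<close> are the elements of \<open>A i\<close> that remain compatible
with all points picked so far.\<close>

lemma transversal:
  fixes r :: "'a rel" and mu :: "'b rel" and A :: "nat \<Rightarrow> 'a set"
  assumes mu: "Card_order mu" "infinite (Field mu)"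
    and f: "set_mapping4 r mu f"
    and gap: "\<And>x0 x1 x2 x3. x0 \<in> Field r \<Longrightarrow> x1 \<in> Field r \<Longrightarrow> x2 \<in> Field r \<Longrightarrow> x3 \<in> Field r \<Longrightarrow>
           strict_rel r x0 x1 \<Longrightarrow> strict_rel r x1 x2 \<Longrightarrow> strict_rel r x2 x3 \<Longrightarrow>
           f {x0, x1, x2, x3} \<inter> open_interval r x1 x2 = {}"
    and A: "\<And>i. A i \<subseteq> Field r" "\<And>i. \<not> |A i| \<le>o mu"
    and less: "\<And>i j a b. \<lbrakk>i < j; a \<in> A i; b \<in> A j\<rbrakk> \<Longrightarrow> strict_rel r a b"
    and below: "\<And>i j z X. \<lbrakk>i < j; z \<in> A j; X \<in> [\<Union>k<i. A k]\<^bsup>3\<^esup>\<rbrakk> \<Longrightarrow> f (insert z X) \<inter> A i = {}"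
    and above: "\<And>i X. X \<in> [\<Union>k<i. A k]\<^bsup>4\<^esup> \<Longrightarrow> f X \<inter> A i = {}"
    and "k \<le> n"
  shows "\<exists>s C. (\<forall>j\<in>{k..<n}. s j \<in> A j) \<and> (\<forall>i<k. C i \<subseteq> A i \<and> \<not> |C i| \<le>o mu) \<and>
           free_set4 f (s ` {k..<n}) \<and>
           (\<forall>i<k. \<forall>x\<in>C i. \<forall>X\<in>[s ` {k..<n}]\<^bsup>3\<^esup>. f (insert x X) \<inter> s ` {k..<n} = {})"
  using \<open>k \<le> n\<close>
\<comment> \<open>Induction from \<open>n\<close> downwards: the hypothesis at \<open>Suc k\<close>
  supplies a candidate set \<open>C k\<close>, from which the next point is taken.\<close>
proof (induction k rule: inc_induct)
  case base
  show ?case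
    using A by (intro exI[of _ undefined] exI[of _ A]) (auto simp: free_set4_def nsets_def)
next
  case (step k)
  from step.IH obtain s C where IH: "\<forall>j\<in>{Suc k..<n}. s j \<in> A j"
    "\<forall>i<Suc k. C i \<subseteq> A i \<and> \<not> |C i| \<le>o mu"
    "free_set4 f (s ` {Suc k..<n})"
    "\<forall>i<Suc k. \<forall>x\<in>C i. \<forall>X\<in>[s ` {Suc k..<n}]\<^bsup>3\<^esup>. f (insert x X) \<inter> s ` {Suc k..<n} = {}"
    by (elim exE conjE) (rule that)
  have s: "s j \<in> A j" if "j \<in> {Suc k..<n}" for j
    using IH(1) that by simp
  have C: "C i \<subseteq> A i" "\<not> |C i| \<le>o mu" if "i < Suc k" for i
    using IH(2) that by simp_all
  note free = IH(3)
  have one: "f (insert x X) \<inter> s ` {Suc k..<n} = {}"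
    if "i < Suc k" "x \<in> C i" "X \<in> [s ` {Suc k..<n}]\<^bsup>3\<^esup>" for i x X
    using IH(4) that by simp
  define S where "S = s ` {Suc k..<n}"
  have finS: "finite S"
    by (simp add: S_def)
  have S: "S \<subseteq> Field r"
    using s A(1) unfolding S_def by blast
  have notin: "x \<notin> S" if "i \<le> k" "x \<in> A i" for i x
  proof
    assume "x \<in> S"
    then obtain j where "j \<in> {Suc k..<n}" "x = s j"
      by (auto simp: S_def)
    then show False
      using that s less[of i j x x] by (simp add: strict_rel_def)
  qed
  define G where "G x = (\<Union>X\<in>[S]\<^bsup>3\<^esup>. f (insert x X))" for x
  have G: "|G x| <o mu" if "i \<le> k" "x \<in> A i" for i x
  proof -
    have "x \<notin> S" "insert x S \<subseteq> Field r"
      using notin[OF that] that(2) A(1) S by auto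
    then have "|f (insert x X)| <o mu" if X: "X \<in> [S]\<^bsup>3\<^esup>" for X
      using set_mapping4_nsets(2)[OF f _ insert_nsets[OF X]] by simp
    then show ?thesis
      unfolding G_def by (intro finite_UNION_ordLess[OF mu] finite_imp_finite_nsets finS)
  qed
  \<comment> \<open>A point \<open>y\<close> outside \<open>bad i\<close> leaves more than mu
    candidates in \<open>C i\<close> whose values on triples from \<open>S\<close> avoid
    \<open>y\<close>.\<close>
  define bad where "bad i = {y. |{x\<in>C i. y \<notin> G x}| \<le>o mu}" for i
  define V where "V = (\<Union>X\<in>[S]\<^bsup>4\<^esup>. f X)"
  have "|V| <o mu"
    unfolding V_def using set_mapping4_nsets(2)[OF f S]
    by (intro finite_UNION_ordLess[OF mu] finite_imp_finite_nsets finS)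
  moreover have "|bad i| \<le>o mu" if "i < k" for i
    unfolding bad_def
  proof (rule few_bad[OF mu])
    show "\<not> |C i| \<le>o mu"
      using C(2) that by simp
    show "|G x| <o mu" if "x \<in> C i" for x
      using G[of i x] C(1)[of i] \<open>i < k\<close> that by auto
  qed
  then have "|\<Union>i\<in>{..<k}. bad i| \<le>o mu"
    by (intro card_of_UNION_ordLeq_infinite_Field[OF mu(2,1)] small_finite[OF mu]) auto
  ultimately have "|V \<union> (\<Union>i\<in>{..<k}. bad i)| \<le>o mu"
    using card_of_Un_ordLeq_infinite_Field[OF mu(2) _ _ mu(1)] ordLess_imp_ordLeq by blast
  \<comment> \<open>Only mu points are forbidden: those in values at quadruples from
    \<open>S\<close>, and those ruining one of the finitely many lower candidate sets.\<close>
  then have "\<not> C k \<subseteq> V \<union> (\<Union>i\<in>{..<k}. bad i)"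
    using C(2)[of k] small_subset by blast
  then obtain y where y: "y \<in> C k" "y \<notin> V" "\<And>i. i < k \<Longrightarrow> y \<notin> bad i"
    by blast
  have yA: "y \<in> A k"
    using y(1) C(1) by blast
  define s' where "s' = s(k := y)"
  define C' where "C' i = {x\<in>C i. y \<notin> G x}" for i
  have s'A: "s' j \<in> A j" if "j \<in> {k..<n}" for j
    using that yA s by (auto simp: s'_def)
  have "{k..<n} = insert k {Suc k..<n}"
    using step.hyps by auto
  then have S': "s' ` {k..<n} = insert y S"
    by (auto simp: s'_def S_def)
  have y_mid: "f (insert x X) \<inter> insert y S = {}"
    if i: "i < k" and x: "x \<in> C' i" and X: "X \<in> [insert y S]\<^bsup>3\<^esup>" for i x X
  proof (cases "y \<in> X")
    case False
    then have "X \<in> [S]\<^bsup>3\<^esup>"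
      using X by (auto simp: nsets_def)
    then show ?thesis
      using one[of i x X] i x by (auto simp: C'_def G_def S_def)
  next
    \<comment> \<open>Here the quadruple is \<open>x\<close>, \<open>y\<close>, \<open>s a\<close>,
      \<open>s b\<close> in increasing order, with \<open>y\<close> the second point. All points of
      \<open>S\<close> lie above \<open>y\<close>, so none can fall between \<open>x\<close> and
      \<open>y\<close>.\<close>
    case True
    have xA: "x \<in> A i"
      using x i C(1)[of i] by (auto simp: C'_def)
    have "X - {y} \<in> [S]\<^bsup>2\<^esup>"
      using X True by (auto simp: nsets_def)
    then obtain u v where uv: "X - {y} = {u, v}" "u \<in> S" "v \<in> S" "u \<noteq> v"
      by (rule nsets2_E)
    obtain a b where ab: "a < b" "b < n" "Suc k \<le> a" "X - {y} = {s a, s b}"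
    proof -
      obtain a b where "u = s a" "v = s b" "a \<in> {Suc k..<n}" "b \<in> {Suc k..<n}"
        using uv(2,3) by (auto simp: S_def)
      then show ?thesis
        using uv(1,4) that[of a b] that[of b a] by (cases a b rule: linorder_cases) auto
    qed
    have sab: "s a \<in> A a" "s b \<in> A b"
      using s ab by auto
    have X_eq: "insert x X = {x, y, s a, s b}"
      using ab(4) True by auto
    have ord: "strict_rel r x y" "strict_rel r y (s a)" "strict_rel r (s a) (s b)"
      using less[OF i xA yA] less[OF _ yA sab(1)] less[OF ab(1) sab] ab(3) by simp_all
    have ne: "x \<noteq> y" "x \<noteq> s a" "y \<noteq> s a" "x \<noteq> s b" "y \<noteq> s b" "s a \<noteq> s b"
      using ord less[of i b x "s b"] less[of k b y "s b"] less[of i a x "s a"] xA yA sab ab i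
      by (auto simp: strict_rel_def)
    then have four: "card {x, y, s a, s b} = 4" and three: "card {x, y, s a} = 3"
      by auto
    have fld: "x \<in> Field r" "y \<in> Field r" "s a \<in> Field r" "s b \<in> Field r"
      using xA yA sab A(1) by blast+
    have disj: "f {x, y, s a, s b} \<inter> {x, y, s a, s b} = {}"
      using set_mapping4_nsets(3)[OF f, of "{x, y, s a, s b}"] fld four by (auto simp: nsets_def)
    have "s c \<notin> f {x, y, s a, s b}" if c: "c \<in> {Suc k..<n}" for c
    proof -
      \<comment> \<open>By the position of \<open>s c\<close>: a point of the quadruple is excluded
        by the set mapping property, the gap between \<open>y\<close> and \<open>s a\<close> by
        \<open>gap\<close>, the one between \<open>s a\<close> and \<open>s b\<close> by
        \<open>below\<close> with \<open>s b\<close> as the later point, and everything after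
        \<open>s b\<close> by \<open>above\<close>.\<close>
      consider "c = a \<or> c = b" | "c < a" | "a < c" "c < b" | "b < c"
        by linarith
      then show ?thesis
      proof cases
        case 1
        then show ?thesis using disj by auto
      next
        case 2
        then have "s c \<in> open_interval r y (s a)"
          using s[OF c] A(1) less[of k c y "s c"] less[of c a "s c" "s a"] yA sab c
          by (auto simp: open_interval_def)
        then show ?thesis
          using gap[OF fld ord] by blast
      next
        case 3
        have "{x, y, s a} \<in> [\<Union>j<c. A j]\<^bsup>3\<^esup>"
          using xA yA sab three 3 ab i by (auto simp: nsets_def)
        then have "f (insert (s b) {x, y, s a}) \<inter> A c = {}"
          using below 3(2) sab(2) by blast
        moreover have "insert (s b) {x, y, s a} = {x, y, s a, s b}"
          by auto
        ultimately show ?thesis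
          using s[OF c] by auto
      next
        case 4
        have "{x, y, s a, s b} \<in> [\<Union>j<c. A j]\<^bsup>4\<^esup>"
          using xA yA sab four 4 ab i by (auto simp: nsets_def)
        then show ?thesis
          using above s[OF c] by blast
      qed
    qed
    then show ?thesis
      using disj unfolding X_eq S_def by auto
  qed
  \<comment> \<open>A quadruple containing \<open>y\<close> misses \<open>S\<close> because
    \<open>y\<close> was a candidate in \<open>C k\<close>; one inside \<open>S\<close> misses
    \<open>y\<close> because \<open>y\<close> is not in \<open>V\<close>.\<close>
  have "free_set4 f (insert y S)"
    unfolding free_set4_def
  proof (intro allI impI)
    fix X assume X: "X \<subseteq> insert y S \<and> finite X \<and> card X = 4"
    show "f X \<inter> insert y S = {}"
    proof (cases "y \<in> X")
      case True
      then have "X - {y} \<in> [S]\<^bsup>3\<^esup>" "insert y (X - {y}) = X"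
        using X by (auto simp: nsets_def)
      then have "f X \<inter> S = {}"
        using one[of k y "X - {y}"] y(1) by (simp add: S_def)
      moreover have "f X \<inter> X = {}"
        using set_mapping4_nsets(3)[OF f, of "insert y S" X] X S yA A(1) by (auto simp: nsets_def)
      ultimately show ?thesis
        using True by blast
    next
      case False
      then have "X \<in> [S]\<^bsup>4\<^esup>"
        using X by (auto simp: nsets_def)
      then show ?thesis
        using free y(2) unfolding free_set4_def S_def[symmetric] V_def by (auto simp: nsets_def)
    qed
  qed
  moreover have "C' i \<subseteq> A i \<and> \<not> |C' i| \<le>o mu" if "i < k" for i
    using y(3)[OF that] C(1)[of i] that by (auto simp: C'_def bad_def)
  ultimately show ?case
    using s'A y_mid by (intro exI[of _ s'] exI[of _ C']) (simp add: S')
qed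

theorem theorem4p1:
  fixes r :: "'a rel" and mu :: "'b rel" and f :: "'a set \<Rightarrow> 'a set"
  assumes "Card_order mu" and "infinite (Field mu)"
    and "Card_order r"
    and "(cardSuc (cardSuc (cardSuc mu)), r) \<in> ordLeq"
    and "set_mapping4 r mu f"
    and "\<And>x0 x1 x2 x3. x0 \<in> Field r \<Longrightarrow> x1 \<in> Field r \<Longrightarrow> x2 \<in> Field r \<Longrightarrow> x3 \<in> Field r \<Longrightarrow>
           strict_rel r x0 x1 \<Longrightarrow> strict_rel r x1 x2 \<Longrightarrow> strict_rel r x2 x3 \<Longrightarrow>
           f {x0, x1, x2, x3} \<inter> open_interval r x1 x2 = {}"
  shows "\<forall>m::nat. \<exists>H. H \<subseteq> Field r \<and> finite H \<and> card H = m \<and> free_set4 f H"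
proof
  fix m :: nat
  obtain A :: "nat \<Rightarrow> 'a set" where A: "\<And>i. A i \<subseteq> Field r" "\<And>i. \<not> |A i| \<le>o mu"
    and less: "\<And>i j a b. \<lbrakk>i < j; a \<in> A i; b \<in> A j\<rbrakk> \<Longrightarrow> strict_rel r a b"
    and "\<And>i j z X. \<lbrakk>i < j; z \<in> A j; X \<in> [\<Union>k<i. A k]\<^bsup>3\<^esup>\<rbrakk> \<Longrightarrow> f (insert z X) \<inter> A i = {}"
    and "\<And>i X. X \<in> [\<Union>k<i. A k]\<^bsup>4\<^esup> \<Longrightarrow> f X \<inter> A i = {}"
    using blocks_exist[OF assms(1-5)] by blast
  note blocks = this
  \<comment> \<open>At \<open>k = 0\<close> one point has been taken from each of the first
    \<open>m\<close> blocks and the conditions on candidates are vacuous.\<close>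
  have "\<exists>s C. (\<forall>j\<in>{0..<m}. s j \<in> A j) \<and> (\<forall>i<0. C i \<subseteq> A i \<and> \<not> |C i| \<le>o mu) \<and>
           free_set4 f (s ` {0..<m}) \<and>
           (\<forall>i<0. \<forall>x\<in>C i. \<forall>X\<in>[s ` {0..<m}]\<^bsup>3\<^esup>. f (insert x X) \<inter> s ` {0..<m} = {})"
    by (rule transversal[of mu r f A 0 m]) (fact assms blocks le0)+
  then obtain s where s: "\<And>j. j < m \<Longrightarrow> s j \<in> A j" and free: "free_set4 f (s ` {0..<m})"
    by (auto simp: Ball_def)
  have "inj_on s {0..<m}"
    using s less by (intro linorder_inj_onI') (fastforce simp: strict_rel_def)
  then have "card (s ` {0..<m}) = m"
    by (simp add: card_image)
  moreover have "s ` {0..<m} \<subseteq> Field r"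
    using s A(1) by fastforce
  ultimately show "\<exists>H. H \<subseteq> Field r \<and> finite H \<and> card H = m \<and> free_set4 f H"
    using free by blast
qed

end
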